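(* Let $\{P_{u,b}\}_{u\in\mathcal U,\,b\in B_u}$ be a measurement setting family on $\mathcal H=(\mathbb C^2)^{\otimes n}$ and let $O=|\psi\rangle\langle\psi|$ with $|\psi\rangle\in\mathcal H$ a unit vector. For an admissible pair $(q,\alpha)$ for $O$, with corresponding one-shot estimator $X$, let $$\mathsf M_{q,\alpha}=\sum_{u\in\mathcal U:\,q(u)>0}\ \sum_{b\in B_u}\frac{\alpha_{u,b}^2}{q(u)}P_{u,b},\qquad \Gamma(q,\alpha;O)=\sup_{\rho}\operatorname{Var}_\rho(X),$$ the supremum being over all density operators $\rho$ on $\mathcal H$. Then for every admissible pair $(q,\alpha)$, $$\Gamma(q,\alpha;O)=\min_{t\in\mathbb R}\Bigl\{\lambda_{\max}\bigl(\mathsf M_{q,\alpha}-2tO\bigr)+t^2\Bigr\}.$$ Consequently, with $\Gamma^\star(O)=\inf_{(q,\alpha)\ \text{admissible}}\Gamma(q,\alpha;O)$, $$\Gamma^{\star}(O)=\inf_{(q,\alpha)\ \text{admissible}}\ \min_{t\in\mathbb R}\Bigl\{\lambda_{\max}\bigl(\mathsf M_{q,\alpha}-2tO\bigr)+t^2\Bigr\}.$$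
   Context: $\mathcal H=(\mathbb C^2)^{\otimes n}$ is the $n$-qubit Hilbert space. A density operator (state) is an operator $\rho\succeq0$ on $\mathcal H$ with $\operatorname{tr}(\rho)=1$. $\lambda_{\max}(A)$ is the largest eigenvalue of a Hermitian operator $A$. A measurement setting family is a finite collection of operators $P_{u,b}\succeq 0$ on $\mathcal H$, indexed by settings $u\in\mathcal U$ and outcomes $b\in B_u$ (finite sets), such that $\sum_{b\in B_u}P_{u,b}=I$ for each $u\in\mathcal U$. An admissible pair $(q,\alpha)$ for $O$ consists of a probability distribution $q$ on $\mathcal U$ and real numbers $\alpha_{u,b}$ ($u\in\mathcal U$, $b\in B_u$) such that $\alpha_{u,b}=0$ for all $b\in B_u$ whenever $q(u)=0$, and $\sum_{u,b}\alpha_{u,b}P_{u,b}=O$ (the unbiasedness identity). The one-shot estimator corresponding to $(q,\alpha)$: when the state is $\rho$, sample $u$ from $q$, then obtain outcome $b\in B_u$ with probability $\operatorname{tr}(\rho P_{u,b})$, and output $X=\alpha_{u,b}/q(u)$. $\operatorname{Var}_\rho(X)$ is the variance of $X$ under this procedure. *)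

theory Defs
  imports "HOL-Analysis.Analysis" "HOL-Probability.Probability"
begin

text \<open>
  The finite type \<open>'n\<close> labels the qubits, so \<open>n = CARD('n)\<close>.  The space
  \<open>(\<complex>\<^sup>2)\<^sup>\<otimes>\<^sup>n\<close> is represented by coordinates in the computational
  basis, which is indexed by the bit strings \<open>'n \<Rightarrow> bool\<close>; operators are matrices in this basis.
  The \<^const>\<open>norm\<close> on \<open>'n qvec\<close> is the Hilbert space norm.
\<close>

type_synonym 'n qvec = "complex ^ ('n \<Rightarrow> bool)"
type_synonym 'n qop = "complex ^ ('n \<Rightarrow> bool) ^ ('n \<Rightarrow> bool)"

definition cinner :: "complex ^ 'd \<Rightarrow> complex ^ 'd \<Rightarrow> complex" where
  "cinner v w = (\<Sum>i\<in>UNIV. cnj (v $ i) * w $ i)"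

definition hermitian :: "complex ^ 'd ^ 'd \<Rightarrow> bool" where
  "hermitian A \<longleftrightarrow> map_matrix cnj (transpose A) = A"

definition psd :: "complex ^ 'd ^ 'd \<Rightarrow> bool" where
  "psd A \<longleftrightarrow> hermitian A \<and> (\<forall>v. 0 \<le> Re (cinner v (A *v v)))"

definition eigenvalue :: "complex ^ 'd ^ 'd \<Rightarrow> complex \<Rightarrow> bool" where
  "eigenvalue A c \<longleftrightarrow> (\<exists>v. v \<noteq> 0 \<and> A *v v = c *s v)"

text \<open>Only meant for Hermitian matrices, all of whose eigenvalues are real.\<close>

definition lambda_max :: "complex ^ 'd ^ 'd \<Rightarrow> real" where
  "lambda_max A = (GREATEST l. eigenvalue A (complex_of_real l))"

definition density :: "complex ^ 'd ^ 'd \<Rightarrow> bool" where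
  "density \<rho> \<longleftrightarrow> psd \<rho> \<and> trace \<rho> = 1"

definition rank_one :: "complex ^ 'd \<Rightarrow> complex ^ 'd ^ 'd" where
  "rank_one \<psi> = (\<chi> i j. \<psi> $ i * cnj (\<psi> $ j))"

definition measurement_family ::
    "'u set \<Rightarrow> ('u \<Rightarrow> 'b set) \<Rightarrow> ('u \<Rightarrow> 'b \<Rightarrow> complex ^ 'd ^ 'd) \<Rightarrow> bool" where
  "measurement_family U B P \<longleftrightarrow>
     finite U \<and> (\<forall>u\<in>U. finite (B u)) \<and>
     (\<forall>u\<in>U. \<forall>b\<in>B u. psd (P u b)) \<and>
     (\<forall>u\<in>U. (\<Sum>b\<in>B u. P u b) = mat 1)"

definition admissible ::
    "'u set \<Rightarrow> ('u \<Rightarrow> 'b set) \<Rightarrow> ('u \<Rightarrow> 'b \<Rightarrow> complex ^ 'd ^ 'd) \<Rightarrow> complex ^ 'd ^ 'd \<Rightarrow>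
     'u pmf \<Rightarrow> ('u \<Rightarrow> 'b \<Rightarrow> real) \<Rightarrow> bool" where
  "admissible U B P Obs q \<alpha> \<longleftrightarrow>
     set_pmf q \<subseteq> U \<and>
     (\<forall>u\<in>U. pmf q u = 0 \<longrightarrow> (\<forall>b\<in>B u. \<alpha> u b = 0)) \<and>
     (\<Sum>u\<in>U. \<Sum>b\<in>B u. \<alpha> u b *\<^sub>R P u b) = Obs"

text \<open>
  For a density operator \<open>\<rho>\<close> and a setting \<open>u\<close> of a measurement family the traces below are
  nonnegative reals adding up to \<open>1\<close>, so \<^const>\<open>embed_pmf\<close> yields the distribution with
  exactly these weights.
\<close>

definition outcome_pmf ::
    "('u \<Rightarrow> 'b set) \<Rightarrow> ('u \<Rightarrow> 'b \<Rightarrow> complex ^ 'd ^ 'd) \<Rightarrow> complex ^ 'd ^ 'd \<Rightarrow> 'u \<Rightarrow> 'b pmf" where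
  "outcome_pmf B P \<rho> u =
     embed_pmf (\<lambda>b. if b \<in> B u then Re (trace (\<rho> ** P u b)) else 0)"

definition sample_pmf ::
    "('u \<Rightarrow> 'b set) \<Rightarrow> ('u \<Rightarrow> 'b \<Rightarrow> complex ^ 'd ^ 'd) \<Rightarrow> 'u pmf \<Rightarrow> complex ^ 'd ^ 'd \<Rightarrow>
     ('u \<times> 'b) pmf" where
  "sample_pmf B P q \<rho> =
     bind_pmf q (\<lambda>u. map_pmf (\<lambda>b. (u, b)) (outcome_pmf B P \<rho> u))"

definition estimator :: "'u pmf \<Rightarrow> ('u \<Rightarrow> 'b \<Rightarrow> real) \<Rightarrow> 'u \<times> 'b \<Rightarrow> real" where
  "estimator q \<alpha> = (\<lambda>(u, b). \<alpha> u b / pmf q u)"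

definition estimator_variance ::
    "('u \<Rightarrow> 'b set) \<Rightarrow> ('u \<Rightarrow> 'b \<Rightarrow> complex ^ 'd ^ 'd) \<Rightarrow> 'u pmf \<Rightarrow> ('u \<Rightarrow> 'b \<Rightarrow> real) \<Rightarrow>
     complex ^ 'd ^ 'd \<Rightarrow> real" where
  "estimator_variance B P q \<alpha> \<rho> =
     measure_pmf.variance (sample_pmf B P q \<rho>) (estimator q \<alpha>)"

text \<open>
  Suprema and infima are taken in \<^typ>\<open>ereal\<close>: they need no boundedness side conditions, and the
  infimum is \<open>\<infinity>\<close> if there is no admissible pair.
\<close>

definition Gamma_wc ::
    "('u \<Rightarrow> 'b set) \<Rightarrow> ('u \<Rightarrow> 'b \<Rightarrow> complex ^ 'd ^ 'd) \<Rightarrow> 'u pmf \<Rightarrow> ('u \<Rightarrow> 'b \<Rightarrow> real) \<Rightarrow> ereal" where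
  "Gamma_wc B P q \<alpha> = (SUP \<rho>\<in>{\<rho>. density \<rho>}. ereal (estimator_variance B P q \<alpha> \<rho>))"

definition Gamma_star ::
    "'u set \<Rightarrow> ('u \<Rightarrow> 'b set) \<Rightarrow> ('u \<Rightarrow> 'b \<Rightarrow> complex ^ 'd ^ 'd) \<Rightarrow> complex ^ 'd ^ 'd \<Rightarrow> ereal" where
  "Gamma_star U B P Obs = (INF (q, \<alpha>)\<in>{(q, \<alpha>). admissible U B P Obs q \<alpha>}. Gamma_wc B P q \<alpha>)"

definition second_moment_op ::
    "'u set \<Rightarrow> ('u \<Rightarrow> 'b set) \<Rightarrow> ('u \<Rightarrow> 'b \<Rightarrow> complex ^ 'd ^ 'd) \<Rightarrow> 'u pmf \<Rightarrow> ('u \<Rightarrow> 'b \<Rightarrow> real) \<Rightarrow>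
     complex ^ 'd ^ 'd" where
  "second_moment_op U B P q \<alpha> =
     (\<Sum>u\<in>{u\<in>U. pmf q u > 0}. \<Sum>b\<in>B u. ((\<alpha> u b)\<^sup>2 / pmf q u) *\<^sub>R P u b)"

definition dual_objective :: "complex ^ 'd ^ 'd \<Rightarrow> complex ^ 'd ^ 'd \<Rightarrow> real \<Rightarrow> real" where
  "dual_objective M Obs t = lambda_max (M - (2 * t) *\<^sub>R Obs) + t\<^sup>2"

text \<open>Meaningful only if the minimum is attained.\<close>

definition min_value :: "(real \<Rightarrow> real) \<Rightarrow> real" where
  "min_value f = (LEAST y. y \<in> range f)"

end

theory Submission
  imports Defs
begin

text \<open>
  The variance in the state \<open>\<rho>\<close> is \<open>F \<rho> = tr (\<rho> M) - (tr (\<rho> O))\<^sup>2\<close>, a concave function on the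
  compact convex set of density operators.  Let \<open>\<rho>\<close> be a maximizer and \<open>t = tr (\<rho> O)\<close>.  The first-order
  condition at \<open>\<rho>\<close> says that \<open>\<rho>\<close> also maximizes the linear functional
  \<open>\<sigma> \<mapsto> tr (\<sigma> (M - 2 t O))\<close>, whose maximum is the largest eigenvalue of \<open>M - 2 t O\<close>; hence the dual
  objective at \<open>t\<close> equals \<open>F \<rho>\<close>.  For every \<open>s\<close> the dual objective at \<open>s\<close> is at least
  \<open>tr (\<rho> (M - 2 s O)) + s\<^sup>2 = F \<rho> + (s - t)\<^sup>2\<close>, so no minimax theorem is needed.
\<close>

abbreviation qform :: "complex ^ 'd ^ 'd \<Rightarrow> complex ^ 'd \<Rightarrow> real" where
  "qform A v \<equiv> Re (cinner v (A *v v))"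

abbreviation expval :: "complex ^ 'd ^ 'd \<Rightarrow> complex ^ 'd ^ 'd \<Rightarrow> real" where
  "expval \<rho> A \<equiv> Re (trace (\<rho> ** A))"

section \<open>Hermitian forms\<close>

lemma cinner_add_left: "cinner (v + w) x = cinner v x + cinner w x"
  and cinner_add_right: "cinner x (v + w) = cinner x v + cinner x w"
  and cinner_diff_right: "cinner x (v - w) = cinner x v - cinner x w"
  and cinner_scale_left: "cinner (c *s v) x = cnj c * cinner v x"
  and cinner_scale_right: "cinner x (c *s v) = c * cinner x v"
  by (simp_all add: cinner_def algebra_simps sum.distrib sum_distrib_left sum_subtractf)

lemma cinner_scaleR_right: "cinner x (r *\<^sub>R v) = r *\<^sub>R cinner x v"
  by (simp add: cinner_def scaleR_sum_right)

lemma cinner_commute: "cinner w v = cnj (cinner v w)"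
  by (simp add: cinner_def mult.commute)

lemma cinner_self: "cinner v v = complex_of_real ((norm v)\<^sup>2)"
  by (simp add: cinner_def norm_vec_def L2_set_def sum_nonneg complex_norm_square mult.commute
      flip: of_real_power)

lemma hermitian_cinner:
  assumes "hermitian A"
  shows "cinner v (A *v w) = cinner (A *v v) w"
proof -
  have herm: "cnj (A $ j $ i) = A $ i $ j" for i j
    using assms unfolding hermitian_def vec_eq_iff by (simp add: map_matrix_def transpose_def)
  have "cinner v (A *v w) = (\<Sum>i\<in>UNIV. \<Sum>j\<in>UNIV. cnj (v $ i) * (A $ i $ j * w $ j))"
    by (simp add: cinner_def matrix_vector_mult_def sum_distrib_left)
  also have "\<dots> = (\<Sum>j\<in>UNIV. \<Sum>i\<in>UNIV. cnj (v $ i) * (A $ i $ j * w $ j))"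
    by (rule sum.swap)
  also have "\<dots> = cinner (A *v v) w"
    by (simp add: cinner_def matrix_vector_mult_def sum_distrib_left sum_distrib_right herm mult_ac)
  finally show ?thesis .
qed

lemma hermitian_add: "hermitian A \<Longrightarrow> hermitian B \<Longrightarrow> hermitian (A + B)"
  and hermitian_diff: "hermitian A \<Longrightarrow> hermitian B \<Longrightarrow> hermitian (A - B)"
  and hermitian_scaleR: "hermitian A \<Longrightarrow> hermitian (r *\<^sub>R A)"
  and hermitian_zero: "hermitian 0"
  and hermitian_mat_1: "hermitian (mat 1)"
  and hermitian_rank_one: "hermitian (rank_one v)"
  by (auto simp: hermitian_def vec_eq_iff map_matrix_def transpose_def mat_def rank_one_def)

lemma hermitian_sum: "(\<And>i. i \<in> I \<Longrightarrow> hermitian (f i)) \<Longrightarrow> hermitian (sum f I)"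
  by (induction I rule: infinite_finite_induct) (auto intro: hermitian_add hermitian_zero)

lemma qform_real:
  assumes "hermitian A"
  shows "cinner v (A *v v) = complex_of_real (qform A v)"
  using hermitian_cinner[OF assms, of v v] cinner_commute[of v "A *v v"]
  by (metis Reals_cnj_iff of_real_Re)

text \<open>Since \<open>A\<close> is Hermitian, the two cross terms are complex conjugates, so they
  add up to twice a real part. The expansion drives the perturbation arguments for psd
  matrices.\<close>

lemma qform_add_scale:
  assumes "hermitian A"
  shows "qform A (x + c *s y) =
    qform A x + 2 * Re (cnj c * cinner y (A *v x)) + (norm c)\<^sup>2 * qform A y"
proof -
  have "c * cinner x (A *v y) = cnj (cnj c * cinner y (A *v x))"
    by (metis assms cinner_commute complex_cnj_cnj complex_cnj_mult hermitian_cinner)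
  then have "Re (c * cinner x (A *v y)) = Re (cnj c * cinner y (A *v x))"
    by (metis complex_cnj(1) cnj.simps(1))
  moreover have "cnj c * (c * cinner y (A *v y)) = complex_of_real ((norm c)\<^sup>2 * qform A y)"
    using qform_real[OF assms, of y] by (simp add: complex_norm_square mult_ac flip: of_real_power)
  ultimately show ?thesis
    by (simp add: matrix_vector_right_distrib vector_scalar_commute
        cinner_add_left cinner_add_right cinner_scale_left cinner_scale_right algebra_simps)
qed

lemma qform_mat_1: "qform (mat 1) v = (norm v)\<^sup>2"
  by (simp add: cinner_self)

lemma rank_one_mult: "rank_one w *v v = cinner w v *s w"
  by (simp add: vec_eq_iff rank_one_def matrix_vector_mult_def cinner_def sum_distrib_left
      sum_distrib_right mult_ac)

lemma qform_rank_one: "qform (rank_one w) v = (norm (cinner w v))\<^sup>2"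
proof -
  have "cinner v (rank_one w *v v) = complex_of_real ((norm (cinner w v))\<^sup>2)"
    unfolding rank_one_mult cinner_scale_right complex_norm_square
    by (simp add: cinner_commute[of v w])
  then show ?thesis by simp
qed

lemma scaleR_matrix_vector: "(r *\<^sub>R A) *v v = r *\<^sub>R (A *v (v :: complex ^ 'd))"
  by (simp add: vec_eq_iff matrix_vector_mult_def scaleR_sum_right)

lemma qform_diff: "qform (A - B) v = qform A v - qform B v"
  by (simp add: matrix_vector_mult_diff_rdistrib cinner_diff_right)

lemma qform_scaleR: "qform (r *\<^sub>R A) v = r * qform A v"
  by (simp add: scaleR_matrix_vector cinner_scaleR_right)

lemma qform_scale: "qform A (c *s v) = (norm c)\<^sup>2 * qform A v"
proof -
  have "cinner (c *s v) (A *v (c *s v)) = complex_of_real ((norm c)\<^sup>2) * cinner v (A *v v)"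
    by (simp add: vector_scalar_commute cinner_scale_left cinner_scale_right complex_norm_square mult_ac
      flip: of_real_power)
  then show ?thesis by (simp del: of_real_power)
qed

section \<open>Positive semidefinite matrices\<close>

text \<open>This is the limit s to 0. It extracts first-order conditions from inequalities with a
  quadratic remainder, once a factor \<open>s\<close> has been cancelled.\<close>

lemma nonpos_if_le_small_multiples:
  fixes a b :: real
  assumes "\<And>s. 0 < s \<Longrightarrow> s \<le> 1 \<Longrightarrow> a \<le> s * b"
  shows "a \<le> 0"
proof (rule ccontr)
  assume "\<not> a \<le> 0"
  \<comment> \<open>With this \<open>s\<close> the product \<open>s * b\<close> is at most
    \<open>a / 2\<close>; the summand 1 keeps the denominator positive.\<close>
  define s where "s = min 1 (a / (2 * (\<bar>b\<bar> + 1)))"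
  have s: "0 < s" "s \<le> 1" using \<open>\<not> a \<le> 0\<close> by (auto simp: s_def)
  have "a \<le> s * b" using assms s by blast
  also have "\<dots> \<le> s * (\<bar>b\<bar> + 1)" using s by (intro mult_left_mono) auto
  also have "\<dots> \<le> a / (2 * (\<bar>b\<bar> + 1)) * (\<bar>b\<bar> + 1)"
    by (intro mult_right_mono) (auto simp: s_def)
  also have "\<dots> = a / 2" by (simp add: field_simps)
  finally show False using \<open>\<not> a \<le> 0\<close> by simp
qed

text \<open>A zero of a nonnegative form is a minimum, so the first-order term vanishes in every
  direction. The direction \<open>- (A *v v)\<close> makes that term
  \<open>- 2 * (norm (A *v v))\<^sup>2\<close>.\<close>

lemma psd_kernel:
  assumes "psd A" "qform A v = 0"
  shows "A *v v = 0"
proof -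
  have herm: "hermitian A" and nonneg: "\<And>x. 0 \<le> qform A x" using assms(1) by (auto simp: psd_def)
  let ?y = "A *v v"
  have "2 * (norm ?y)\<^sup>2 \<le> s * qform A ?y" if "0 < s" for s :: real
  proof -
    have "0 \<le> qform A (v + complex_of_real (- s) *s ?y)" by (rule nonneg)
    also have "\<dots> = - 2 * s * (norm ?y)\<^sup>2 + s\<^sup>2 * qform A ?y"
      unfolding qform_add_scale[OF herm] using assms(2) by (simp add: cinner_self flip: of_real_power)
    finally have "s * (2 * (norm ?y)\<^sup>2) \<le> s * (s * qform A ?y)"
      by (simp add: power2_eq_square algebra_simps)
    then show ?thesis using that by simp
  qed
  then have "2 * (norm ?y)\<^sup>2 \<le> 0" by (intro nonpos_if_le_small_multiples) auto
  then show ?thesis by simp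
qed

text \<open>The Schur complement of a psd matrix along a vector; applied to the identity, it is the
  Cauchy--Schwarz inequality.\<close>

lemma psd_schur_complement:
  assumes "psd A" "qform A x \<noteq> 0"
  shows "psd (A - (1 / qform A x) *\<^sub>R rank_one (A *v x))"
proof -
  have herm: "hermitian A" and nonneg: "\<And>x. 0 \<le> qform A x" using assms(1) by (auto simp: psd_def)
  have "0 \<le> qform (A - (1 / qform A x) *\<^sub>R rank_one (A *v x)) v" for v
  proof -
    define z where "z = cinner x (A *v v)"
    \<comment> \<open>This \<open>c\<close> minimizes the form at \<open>v + c *s x\<close>; the
      minimal value is exactly the form of the Schur complement at \<open>v\<close>.\<close>
    define c where "c = - z / complex_of_real (qform A x)"
    have nc: "(norm c)\<^sup>2 = (norm z)\<^sup>2 / (qform A x)\<^sup>2"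
      by (simp add: c_def norm_divide power_divide)
    have "cnj c * z = - complex_of_real ((norm z)\<^sup>2 / qform A x)"
      by (simp add: c_def complex_norm_square mult.commute flip: of_real_power)
    then have rc: "Re (cnj c * z) = - ((norm z)\<^sup>2 / qform A x)" by simp
    have "0 \<le> qform A (v + c *s x)" by (rule nonneg)
    also have "\<dots> = qform A v - 2 * ((norm z)\<^sup>2 / qform A x) + (norm z)\<^sup>2 / (qform A x)\<^sup>2 * qform A x"
      unfolding qform_add_scale[OF herm] z_def[symmetric] rc nc by simp
    also have "\<dots> = qform A v - (norm z)\<^sup>2 / qform A x"
      using assms(2) by (simp add: power2_eq_square)
    finally show ?thesis
      by (simp only: qform_diff qform_scaleR qform_rank_one z_def hermitian_cinner[OF herm]) simp
  qed
  then show ?thesis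
    unfolding psd_def using herm by (auto intro: hermitian_diff hermitian_scaleR hermitian_rank_one)
qed

section \<open>Expectation values\<close>

lemma expval_sum: "expval \<rho> A = (\<Sum>i\<in>UNIV. \<Sum>j\<in>UNIV. Re (\<rho> $ i $ j * A $ j $ i))"
  by (simp add: trace_def matrix_matrix_mult_def)

lemma linear_expval_left: "linear (\<lambda>\<rho>. expval \<rho> A)"
  unfolding expval_sum
  by (rule linearI) (simp_all add: algebra_simps sum.distrib sum_distrib_left sum_subtractf)

lemma linear_expval_right: "linear (\<lambda>A. expval \<rho> A)"
  unfolding expval_sum
  by (rule linearI) (simp_all add: algebra_simps sum.distrib sum_distrib_left sum_subtractf)

lemmas expval_simps =
  linear_add[OF linear_expval_left] linear_diff[OF linear_expval_left]
  linear_scale[OF linear_expval_left] linear_sum[OF linear_expval_left]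
  linear_add[OF linear_expval_right] linear_diff[OF linear_expval_right]
  linear_scale[OF linear_expval_right] linear_sum[OF linear_expval_right]

lemma expval_rank_one: "expval (rank_one v) A = qform A v"
proof -
  have "trace (rank_one v ** A) = (\<Sum>i\<in>UNIV. \<Sum>j\<in>UNIV. v $ i * cnj (v $ j) * A $ j $ i)"
    by (simp add: trace_def matrix_matrix_mult_def rank_one_def)
  also have "\<dots> = (\<Sum>j\<in>UNIV. \<Sum>i\<in>UNIV. v $ i * cnj (v $ j) * A $ j $ i)"
    by (rule sum.swap)
  also have "\<dots> = cinner v (A *v v)"
    by (simp add: cinner_def matrix_vector_mult_def sum_distrib_left mult_ac)
  finally show ?thesis by simp
qed

lemma expval_commute: "expval \<rho> A = expval A \<rho>"
  by (metis trace_mul_sym)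

text \<open>Peeling off a basis vector by a Schur complement empties one more diagonal entry: the
  Cholesky decomposition of \<open>A\<close>.\<close>

lemma expval_psd_nonneg:
  assumes "psd A" "psd B"
  shows "0 \<le> expval A B"
proof -
  \<comment> \<open>Induction over a set \<open>S\<close> containing the indices of all nonzero
    diagonal entries, with \<open>A\<close> arbitrary because it is replaced by a Schur
    complement.\<close>
  have "0 \<le> expval A B" if "finite S" "psd A" "{j. qform A (axis j 1) \<noteq> 0} \<subseteq> S" for S A
    using that
  proof (induction S arbitrary: A rule: finite_induct)
    case empty
    \<comment> \<open>The whole diagonal is zero, so \<open>A\<close> annihilates every basis vector
      and vanishes.\<close>
    then have "A *v axis j 1 = 0" for j by (intro psd_kernel) auto
    moreover have "A $ i $ j = (A *v axis j 1) $ i" for i j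
      by (simp add: matrix_vector_mult_def axis_def if_distrib cong: if_cong)
    ultimately have "A = 0" by (simp add: vec_eq_iff)
    then show ?case by (simp add: trace_def)
  next
    case (insert i S)
    let ?x = "axis i 1 :: complex ^ 'a"
    show ?case
    proof (cases "qform A ?x = 0")
      case True
      then have "{j. qform A (axis j 1) \<noteq> 0} \<subseteq> S" using insert.prems(2) by auto
      then show ?thesis using insert.IH insert.prems(1) by blast
    next
      case False
      define A' where "A' = A - (1 / qform A ?x) *\<^sub>R rank_one (A *v ?x)"
      have herm: "hermitian A" and nonneg: "\<And>x. 0 \<le> qform A x"
        using insert.prems(1) by (auto simp: psd_def)
      have psd': "psd A'" unfolding A'_def by (rule psd_schur_complement[OF insert.prems(1) False])
      have eq: "qform A' v = qform A v - (norm (cinner (A *v ?x) v))\<^sup>2 / qform A ?x" for v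
        by (simp only: A'_def qform_diff qform_scaleR qform_rank_one) simp
      have "cinner (A *v ?x) ?x = complex_of_real (qform A ?x)"
        using qform_real[OF herm] hermitian_cinner[OF herm] by metis
      then have zero_i: "qform A' ?x = 0" unfolding eq using False by (simp add: power2_eq_square)
      \<comment> \<open>Subtracting a psd matrix cannot increase diagonal entries, and
        \<open>A'\<close> is still psd. Entries that were zero therefore stay zero, while entry
        \<open>i\<close> has just been cleared.\<close>
      have "qform A' (axis j 1) = 0" if "j \<notin> S" for j
      proof (cases "j = i")
        case True
        then show ?thesis using zero_i by simp
      next
        case False
        then have "qform A (axis j 1) = 0" using that insert.prems(2) by auto
        then have "qform A' (axis j 1) \<le> 0" unfolding eq using nonneg by simp
        then show ?thesis using psd' by (simp add: psd_def order_antisym)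
      qed
      then have "0 \<le> expval A' B" by (intro insert.IH[OF psd']) auto
      \<comment> \<open>The removed rank-one part pairs with \<open>B\<close> to a value of the form
        of \<open>B\<close>, which is nonnegative.\<close>
      moreover have "expval A B = expval A' B + 1 / qform A ?x * qform B (A *v ?x)"
        by (simp add: A'_def expval_simps expval_rank_one)
      moreover have "0 \<le> 1 / qform A ?x * qform B (A *v ?x)"
        using nonneg assms(2) by (simp add: psd_def)
      ultimately show ?thesis by linarith
    qed
  qed
  from this[of UNIV A] show ?thesis using assms(1) by auto
qed

section \<open>Density operators: compactness and convexity\<close>

lemma density_rank_one:
  assumes "norm v = 1"
  shows "density (rank_one v)"
proof -
  have "trace (rank_one v) = cinner v v"
    by (simp add: trace_def rank_one_def cinner_def mult.commute)
  then show ?thesis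
    using assms unfolding density_def psd_def qform_rank_one
    by (auto simp: cinner_self intro: hermitian_rank_one)
qed

text \<open>Both \<rho> and \<open>mat 1 - \<rho>\<close> are psd, so their trace pairing is
  nonnegative and tr(\<rho>^2) \<le> tr(\<rho>) = 1. For Hermitian \<rho>, tr(\<rho>^2) is the
  square of the entrywise Euclidean norm. This supplies the boundedness for compactness.\<close>

lemma norm_density_le:
  assumes "density \<rho>"
  shows "norm \<rho> \<le> 1"
proof -
  have psd: "psd \<rho>" and herm: "hermitian \<rho>" and tr: "trace \<rho> = 1"
    using assms by (auto simp: density_def psd_def)
  \<comment> \<open>\<rho> is paired with the projection onto the orthogonal complement of
    \<open>v\<close>, which is the Schur complement of the identity along \<open>v\<close>.\<close>
  have "qform \<rho> v \<le> (norm v)\<^sup>2" for v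
  proof (cases "v = 0")
    case False
    have "psd (mat 1 :: complex ^ 'a ^ 'a)"
      unfolding psd_def qform_mat_1 by (simp add: hermitian_mat_1)
    then have "psd (mat 1 - (1 / qform (mat 1) v) *\<^sub>R rank_one (mat 1 *v v))"
      using False by (intro psd_schur_complement) (auto simp: qform_mat_1 simp del: matrix_vector_mul_lid)
    then have "0 \<le> expval \<rho> (mat 1 - (1 / (norm v)\<^sup>2) *\<^sub>R rank_one v)"
      by (intro expval_psd_nonneg[OF psd]) (simp add: cinner_self flip: of_real_power)
    also have "\<dots> = 1 - qform \<rho> v / (norm v)\<^sup>2"
      by (simp add: expval_simps tr expval_commute[of \<rho> "rank_one v"] expval_rank_one)
    finally show ?thesis using False by (simp add: field_simps)
  qed (simp add: cinner_def)
  then have "psd (mat 1 - \<rho>)"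
    unfolding psd_def qform_diff qform_mat_1 by (auto intro: hermitian_diff hermitian_mat_1 herm)
  then have "0 \<le> expval \<rho> (mat 1 - \<rho>)" by (rule expval_psd_nonneg[OF psd])
  then have "expval \<rho> \<rho> \<le> 1" by (simp add: expval_simps tr)
  moreover have "expval \<rho> \<rho> = (norm \<rho>)\<^sup>2"
  proof -
    have "cnj (\<rho> $ j $ i) = \<rho> $ i $ j" for i j
      using herm unfolding hermitian_def vec_eq_iff by (simp add: map_matrix_def transpose_def)
    then have "Re (\<rho> $ i $ j * \<rho> $ j $ i) = (norm (\<rho> $ i $ j))\<^sup>2" for i j
      by (metis Re_complex_of_real complex_norm_square)
    then show ?thesis
      unfolding expval_sum by (simp add: norm_vec_def L2_set_def sum_nonneg)
  qed
  ultimately show ?thesis by (simp add: power_le_one_iff)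
qed

lemma compact_density: "compact {\<rho> :: complex ^ 'd ^ 'd. density \<rho>}"
proof -
  have "{\<rho> :: complex ^ 'd ^ 'd. density \<rho>} =
      {\<rho>. map_matrix cnj (transpose \<rho>) = \<rho>} \<inter> (\<Inter>v. {\<rho>. 0 \<le> qform \<rho> v}) \<inter> {\<rho>. trace \<rho> = 1}"
    by (auto simp: density_def psd_def hermitian_def)
  moreover have "closed {\<rho> :: complex ^ 'd ^ 'd. map_matrix cnj (transpose \<rho>) = \<rho>}"
    unfolding map_matrix_def transpose_def by (intro closed_Collect_eq continuous_intros)
  moreover have "closed {\<rho> :: complex ^ 'd ^ 'd. 0 \<le> qform \<rho> v}" for v
    unfolding cinner_def matrix_vector_mult_def vec_lambda_beta
    by (intro closed_Collect_le continuous_intros)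
  moreover have "closed {\<rho> :: complex ^ 'd ^ 'd. trace \<rho> = 1}"
    unfolding trace_def by (intro closed_Collect_eq continuous_intros)
  ultimately have "closed {\<rho> :: complex ^ 'd ^ 'd. density \<rho>}"
    by (auto intro!: closed_Int closed_INT)
  moreover have "bounded {\<rho> :: complex ^ 'd ^ 'd. density \<rho>}"
    unfolding bounded_iff using norm_density_le by blast
  ultimately show ?thesis by (simp add: compact_eq_bounded_closed)
qed

text \<open>Convexity of the set of states, written as a step from \<rho> towards \<sigma> so that
  directional derivatives can be read off.\<close>

lemma density_segment:
  assumes "density \<rho>" "density \<sigma>" "0 \<le> s" "s \<le> 1"
  shows "density (\<rho> + s *\<^sub>R (\<sigma> - \<rho>))"
proof -
  have "qform (\<rho> + s *\<^sub>R (\<sigma> - \<rho>)) v = (1 - s) * qform \<rho> v + s * qform \<sigma> v" for v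
    unfolding expval_rank_one[symmetric] by (simp only: expval_simps) (simp add: algebra_simps)
  moreover have "trace (\<rho> + s *\<^sub>R (\<sigma> - \<rho>)) = trace \<rho> + s *\<^sub>R (trace \<sigma> - trace \<rho>)"
    by (simp add: trace_def sum.distrib sum_subtractf scaleR_sum_right scaleR_diff_right)
  ultimately show ?thesis
    using assms unfolding density_def psd_def
    by (auto intro: hermitian_add hermitian_diff hermitian_scaleR)
qed

section \<open>The largest eigenvalue as a maximum over states\<close>

text \<open>The form attains its maximum \<open>l\<close> on the compact unit sphere at some
  \<open>v\<close>. Then \<open>l *\<^sub>R mat 1 - A\<close> is psd and its form vanishes at
  \<open>v\<close>, so \<open>v\<close> is an eigenvector. The bound for mixed states comes from
  pairing \<rho> with this psd matrix.\<close>

lemma lambda_max_hermitian: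
  fixes A :: "complex ^ 'd ^ 'd"
  assumes "hermitian A"
  shows lambda_max_attained: "\<exists>v. norm v = 1 \<and> qform A v = lambda_max A"
    and expval_le_lambda_max: "density \<rho> \<Longrightarrow> expval \<rho> A \<le> lambda_max A"
proof -
  have "continuous_on (sphere 0 1) (qform A)"
    unfolding cinner_def matrix_vector_mult_def vec_lambda_beta by (intro continuous_intros)
  moreover have "axis undefined 1 \<in> sphere (0 :: complex ^ 'd) 1" by simp
  ultimately obtain v where v: "norm v = 1" and max: "\<And>w. norm w = 1 \<Longrightarrow> qform A w \<le> qform A v"
    using continuous_attains_sup[of "sphere (0 :: complex ^ 'd) 1" "qform A"] by auto
  let ?l = "qform A v"
  define D where "D = ?l *\<^sub>R mat 1 - A"
  have qD: "qform D w = ?l * (norm w)\<^sup>2 - qform A w" for w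
    by (simp only: D_def qform_diff qform_scaleR qform_mat_1)
  have nonneg: "0 \<le> qform D w" for w
  \<comment> \<open>Maximality is known on unit vectors only; normalizing \<open>w\<close> extends
    it by homogeneity.\<close>
  proof (cases "w = 0")
    case False
    define u where "u = complex_of_real (1 / norm w) *s w"
    have "w = complex_of_real (norm w) *s u" using False by (simp add: u_def)
    then have "qform A w = (norm w)\<^sup>2 * qform A u"
      by (metis abs_norm_cancel norm_of_real qform_scale)
    moreover have "(norm u)\<^sup>2 = 1"
      using qform_scale[of _ w "mat 1"] False
      unfolding u_def qform_mat_1[symmetric] by (simp add: cinner_self norm_divide power_divide flip: of_real_power)
    then have "qform A u \<le> ?l" by (intro max) (smt (verit) norm_ge_zero power2_eq_1_iff)
    ultimately show ?thesis unfolding qD by (simp add: mult.commute mult_right_mono)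
  qed (simp add: cinner_def)
  with assms have psdD: "psd D"
    unfolding psd_def D_def by (auto intro: hermitian_diff hermitian_scaleR hermitian_mat_1)
  then have "D *v v = 0" by (rule psd_kernel) (simp only: qD v, simp)
  then have "A *v v = ?l *\<^sub>R v"
    by (simp add: D_def matrix_vector_mult_diff_rdistrib scaleR_matrix_vector)
  then have "A *v v = complex_of_real ?l *s v"
    by (simp add: vec_eq_iff scaleR_conv_of_real[where 'a = complex])
  then have "eigenvalue A (complex_of_real ?l)"
    unfolding eigenvalue_def using v by (intro exI[of _ v]) auto
  \<comment> \<open>A real eigenvalue is the Rayleigh quotient of its eigenvector, hence at most the
    maximum.\<close>
  moreover have "l \<le> ?l" if "eigenvalue A (complex_of_real l)" for l
  proof -
    obtain w where w: "w \<noteq> 0" "A *v w = complex_of_real l *s w"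
      using \<open>eigenvalue A (complex_of_real l)\<close> unfolding eigenvalue_def by blast
    then have "qform A w = l * (norm w)\<^sup>2" by (simp add: cinner_scale_right cinner_self flip: of_real_power)
    then have "l * (norm w)\<^sup>2 \<le> ?l * (norm w)\<^sup>2" using qD[of w] nonneg[of w] by simp
    then show ?thesis using w(1) by simp
  qed
  ultimately have l: "lambda_max A = ?l"
    unfolding lambda_max_def by (intro Greatest_equality)
  then show "\<exists>v. norm v = 1 \<and> qform A v = lambda_max A" using v by metis
  assume "density \<rho>"
  then have "0 \<le> expval \<rho> D" "trace \<rho> = 1" using psdD by (auto simp: density_def intro: expval_psd_nonneg)
  then show "expval \<rho> A \<le> lambda_max A" unfolding l by (simp add: D_def expval_simps)
qed

section \<open>The dual problem\<close>

text \<open>The maximizing state and the minimizing parameter are obtained together: equality of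
  their values gives both attainment and the absence of a duality gap.\<close>

lemma variance_duality:
  fixes M Obs :: "complex ^ 'd ^ 'd"
  assumes "hermitian M" "hermitian Obs"
  obtains \<rho> t where "density \<rho>"
    and "\<And>\<sigma>. density \<sigma> \<Longrightarrow> expval \<sigma> M - (expval \<sigma> Obs)\<^sup>2 \<le> expval \<rho> M - (expval \<rho> Obs)\<^sup>2"
    and "dual_objective M Obs t = expval \<rho> M - (expval \<rho> Obs)\<^sup>2"
    and "\<And>s. dual_objective M Obs t \<le> dual_objective M Obs s"
proof -
  define F where "F \<sigma> = expval \<sigma> M - (expval \<sigma> Obs)\<^sup>2" for \<sigma>
  have "continuous_on {\<rho>. density \<rho>} F"
    unfolding F_def by (intro continuous_intros linear_continuous_on
      linear_expval_left[unfolded linear_conv_bounded_linear])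
  moreover have "{\<rho> :: complex ^ 'd ^ 'd. density \<rho>} \<noteq> {}"
    using density_rank_one[of "axis undefined 1"] by auto
  ultimately obtain \<rho> where \<rho>: "density \<rho>" and max: "\<And>\<sigma>. density \<sigma> \<Longrightarrow> F \<sigma> \<le> F \<rho>"
    using continuous_attains_sup[OF compact_density] by (metis mem_Collect_eq)
  define t where "t = expval \<rho> Obs"
  have herm: "hermitian (M - (2 * s) *\<^sub>R Obs)" for s
    using assms by (intro hermitian_diff hermitian_scaleR)
  have lower: "F \<rho> \<le> dual_objective M Obs s" for s
  proof -
    \<comment> \<open>Completing the square: \<open>- t\<^sup>2 + (s - t)\<^sup>2\<close> equals
      \<open>- 2 * s * t + s\<^sup>2\<close>, so the right-hand side is affine in the state apart
      from \<open>s\<^sup>2\<close>.\<close>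
    have "F \<rho> \<le> F \<rho> + (s - t)\<^sup>2" by simp
    also have "\<dots> = expval \<rho> (M - (2 * s) *\<^sub>R Obs) + s\<^sup>2"
      by (simp add: F_def t_def expval_simps power2_eq_square algebra_simps)
    also have "\<dots> \<le> dual_objective M Obs s"
      unfolding dual_objective_def using expval_le_lambda_max[OF herm \<rho>] by simp
    finally show ?thesis .
  qed
  have "dual_objective M Obs t = F \<rho>"
  proof (rule antisym[OF _ lower])
    obtain v where v: "norm v = 1" "qform (M - (2 * t) *\<^sub>R Obs) v = lambda_max (M - (2 * t) *\<^sub>R Obs)"
      using lambda_max_attained[OF herm] by blast
    define \<sigma> where "\<sigma> = rank_one v"
    have \<sigma>: "density \<sigma>" unfolding \<sigma>_def by (rule density_rank_one[OF v(1)])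
    \<comment> \<open>Along the segment from \<rho> to \<sigma>, \<open>F\<close> is exactly
      \<open>F \<rho> + s * a - s\<^sup>2 * b\<^sup>2\<close>: \<open>a\<close> is the slope at
      \<rho> and \<open>b\<close> gives the curvature.\<close>
    define a where "a = expval (\<sigma> - \<rho>) M - 2 * t * expval (\<sigma> - \<rho>) Obs"
    define b where "b = expval (\<sigma> - \<rho>) Obs"
    have "a \<le> s * b\<^sup>2" if "0 < s" "s \<le> 1" for s
    proof -
      have "F (\<rho> + s *\<^sub>R (\<sigma> - \<rho>)) \<le> F \<rho>"
        using that by (intro max density_segment \<rho> \<sigma>) auto
      moreover have "F (\<rho> + s *\<^sub>R (\<sigma> - \<rho>)) = F \<rho> + s * (a - s * b\<^sup>2)"
        by (simp add: F_def a_def b_def t_def linear_add[OF linear_expval_left]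
            linear_scale[OF linear_expval_left] power2_eq_square distrib_left
            distrib_right left_diff_distrib right_diff_distrib)
      ultimately show ?thesis using that by (simp add: mult_le_0_iff)
    qed
    then have "a \<le> 0" by (rule nonpos_if_le_small_multiples)
    \<comment> \<open>Because \<sigma> is the projection onto a top eigenvector of
      \<open>M - (2 * t) *\<^sub>R Obs\<close>, the slope \<open>a\<close> is precisely the excess
      of the dual value over \<open>F \<rho>\<close>.\<close>
    moreover have "dual_objective M Obs t = F \<rho> + a"
      unfolding dual_objective_def v(2)[symmetric] expval_rank_one[symmetric] \<sigma>_def[symmetric]
      by (simp add: F_def a_def t_def expval_simps power2_eq_square algebra_simps)
    ultimately show "dual_objective M Obs t \<le> F \<rho>" by simp
  qed
  with \<rho> max lower show ?thesis using that[of \<rho> t] unfolding F_def by metis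
qed

section \<open>The variance of the estimator\<close>

text \<open>\<open>embed_pmf\<close> has the prescribed weights only if they are nonnegative and sum
  to 1. The first holds by the trace pairing of psd matrices, the second by completeness of the
  measurement and unit trace.\<close>

lemma pmf_outcome_pmf:
  assumes "measurement_family U B P" "u \<in> U" "density \<rho>"
  shows "pmf (outcome_pmf B P \<rho> u) b = (if b \<in> B u then expval \<rho> (P u b) else 0)"
    and "set_pmf (outcome_pmf B P \<rho> u) \<subseteq> B u"
proof -
  let ?f = "\<lambda>b. if b \<in> B u then expval \<rho> (P u b) else 0"
  have fin: "finite (B u)" and sum1: "(\<Sum>b\<in>B u. P u b) = mat 1"
    and nonneg: "\<And>b. b \<in> B u \<Longrightarrow> 0 \<le> expval \<rho> (P u b)"
    using assms by (auto simp: measurement_family_def density_def intro!: expval_psd_nonneg)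
  have "(\<Sum>b\<in>B u. expval \<rho> (P u b)) = 1"
    using assms(3) by (simp add: linear_sum[OF linear_expval_right, symmetric] sum1 density_def)
  moreover have "(\<integral>\<^sup>+ b. ennreal (?f b) \<partial>count_space UNIV) = ennreal (\<Sum>b\<in>B u. expval \<rho> (P u b))"
  proof -
    have "(\<integral>\<^sup>+ b. ennreal (?f b) \<partial>count_space UNIV) = (\<Sum>b\<in>B u. ennreal (?f b))"
      using fin by (intro nn_integral_count_space') auto
    also have "\<dots> = ennreal (\<Sum>b\<in>B u. expval \<rho> (P u b))"
      using nonneg by (simp add: sum_ennreal)
    finally show ?thesis .
  qed
  ultimately have *: "pmf (outcome_pmf B P \<rho> u) b = ?f b" for b
    unfolding outcome_pmf_def using nonneg by (intro pmf_embed_pmf) auto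
  then show "pmf (outcome_pmf B P \<rho> u) b = ?f b" by blast
  show "set_pmf (outcome_pmf B P \<rho> u) \<subseteq> B u"
    using * by (auto simp: set_pmf_iff split: if_splits)
qed

text \<open>All supports are finite, so the expectation is a finite double sum; finiteness of the
  support also provides integrability for the variance formula.\<close>

lemma expectation_sample_pmf:
  fixes f :: "'u \<times> 'b \<Rightarrow> real"
  assumes "measurement_family U B P" "set_pmf q \<subseteq> U" "density \<rho>"
  shows "measure_pmf.expectation (sample_pmf B P q \<rho>) f =
      (\<Sum>u\<in>U. \<Sum>b\<in>B u. pmf q u * f (u, b) * expval \<rho> (P u b))"
    and "finite (set_pmf (sample_pmf B P q \<rho>))"
proof -
  have fin: "finite U" "\<And>u. u \<in> U \<Longrightarrow> finite (B u)"
    using assms(1) by (auto simp: measurement_family_def)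
  have fin_out: "finite (set_pmf (outcome_pmf B P \<rho> u))" if "u \<in> U" for u
    using pmf_outcome_pmf(2)[OF assms(1) that assms(3)] fin(2)[OF that] by (rule finite_subset)
  show "finite (set_pmf (sample_pmf B P q \<rho>))"
    unfolding sample_pmf_def using fin_out assms(2) finite_subset[OF assms(2) fin(1)] by auto
  have "measure_pmf.expectation (sample_pmf B P q \<rho>) f =
      (\<Sum>u\<in>U. pmf q u *\<^sub>R measure_pmf.expectation (map_pmf (Pair u) (outcome_pmf B P \<rho> u)) f)"
    unfolding sample_pmf_def using fin_out assms(2) fin(1) by (intro pmf_expectation_bind) auto
  also have "\<dots> = (\<Sum>u\<in>U. \<Sum>b\<in>B u. pmf q u * f (u, b) * expval \<rho> (P u b))"
  proof (rule sum.cong[OF refl])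
    fix u assume u: "u \<in> U"
    have "measure_pmf.expectation (map_pmf (Pair u) (outcome_pmf B P \<rho> u)) f =
        (\<Sum>b\<in>B u. f (u, b) * pmf (outcome_pmf B P \<rho> u) b)"
      using pmf_outcome_pmf(2)[OF assms(1) u assms(3)] fin(2)[OF u]
      by (simp add: integral_measure_pmf_real[where A = "B u"] subset_iff)
    then show "pmf q u *\<^sub>R measure_pmf.expectation (map_pmf (Pair u) (outcome_pmf B P \<rho> u)) f =
        (\<Sum>b\<in>B u. pmf q u * f (u, b) * expval \<rho> (P u b))"
      using pmf_outcome_pmf(1)[OF assms(1) u assms(3)] by (simp add: sum_distrib_left mult_ac)
  qed
  finally show "measure_pmf.expectation (sample_pmf B P q \<rho>) f =
      (\<Sum>u\<in>U. \<Sum>b\<in>B u. pmf q u * f (u, b) * expval \<rho> (P u b))" .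
qed

lemma estimator_variance_eq:
  assumes mf: "measurement_family U B P" and adm: "admissible U B P Obs q \<alpha>" and \<rho>: "density \<rho>"
  shows "estimator_variance B P q \<alpha> \<rho> =
    expval \<rho> (second_moment_op U B P q \<alpha>) - (expval \<rho> Obs)\<^sup>2"
proof -
  have q: "set_pmf q \<subseteq> U" and zero: "\<And>u b. u \<in> U \<Longrightarrow> pmf q u = 0 \<Longrightarrow> b \<in> B u \<Longrightarrow> \<alpha> u b = 0"
    and unbiased: "(\<Sum>u\<in>U. \<Sum>b\<in>B u. \<alpha> u b *\<^sub>R P u b) = Obs"
    using adm by (auto simp: admissible_def)
  have finU: "finite U" using mf by (simp add: measurement_family_def)
  note ex = expectation_sample_pmf[OF mf q \<rho>]
  \<comment> \<open>The factor \<open>pmf q u\<close> cancels the denominator of the estimator; at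
    settings of probability zero, admissibility forces the coefficient to be 0.\<close>
  have "measure_pmf.expectation (sample_pmf B P q \<rho>) (estimator q \<alpha>) =
      (\<Sum>u\<in>U. \<Sum>b\<in>B u. \<alpha> u b * expval \<rho> (P u b))"
    unfolding ex estimator_def using zero by (intro sum.cong) (auto simp: divide_simps)
  also have "\<dots> = expval \<rho> Obs"
    unfolding unbiased[symmetric] by (simp add: expval_simps)
  finally have first: "measure_pmf.expectation (sample_pmf B P q \<rho>) (estimator q \<alpha>) = expval \<rho> Obs" .
  \<comment> \<open>One factor \<open>pmf q u\<close> remains in the denominator. Where it is 0,
    both sides are 0 since \<open>x / 0 = 0\<close>, so the sum can then be restricted to positive
    probabilities.\<close>
  have "measure_pmf.expectation (sample_pmf B P q \<rho>) (\<lambda>x. (estimator q \<alpha> x)\<^sup>2) =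
      (\<Sum>u\<in>U. \<Sum>b\<in>B u. (\<alpha> u b)\<^sup>2 / pmf q u * expval \<rho> (P u b))"
    unfolding ex estimator_def by (intro sum.cong) (auto simp: divide_simps power2_eq_square)
  also have "\<dots> = (\<Sum>u\<in>{u\<in>U. pmf q u > 0}. \<Sum>b\<in>B u. (\<alpha> u b)\<^sup>2 / pmf q u * expval \<rho> (P u b))"
    using finU by (intro sum.mono_neutral_right) (auto simp: not_less order_antisym)
  also have "\<dots> = expval \<rho> (second_moment_op U B P q \<alpha>)"
    unfolding second_moment_op_def by (simp add: expval_simps)
  finally have second: "measure_pmf.expectation (sample_pmf B P q \<rho>) (\<lambda>x. (estimator q \<alpha> x)\<^sup>2) =
      expval \<rho> (second_moment_op U B P q \<alpha>)" .
  show ?thesis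
    unfolding estimator_variance_def first[symmetric] second[symmetric]
    using ex(2) by (intro measure_pmf.variance_eq integrable_measure_pmf_finite)
qed

text \<open>The supremum is attained at the optimal state of \<open>variance_duality\<close>, hence
  it is finite; the exhibited minimizer makes \<open>min_value\<close> a genuine minimum.\<close>

lemma Gamma_wc_eq:
  assumes mf: "measurement_family U B P" and herm: "hermitian Obs"
    and adm: "admissible U B P Obs q \<alpha>"
  defines "f \<equiv> dual_objective (second_moment_op U B P q \<alpha>) Obs"
  shows "\<exists>t. is_arg_min f (\<lambda>_. True) t" and "Gamma_wc B P q \<alpha> = ereal (min_value f)"
proof -
  let ?M = "second_moment_op U B P q \<alpha>"
  have "hermitian ?M"
    unfolding second_moment_op_def using mf
    by (auto intro!: hermitian_sum hermitian_scaleR simp: measurement_family_def psd_def)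
  then obtain \<rho> t where \<rho>: "density \<rho>"
    and max: "\<And>\<sigma>. density \<sigma> \<Longrightarrow> expval \<sigma> ?M - (expval \<sigma> Obs)\<^sup>2 \<le> expval \<rho> ?M - (expval \<rho> Obs)\<^sup>2"
    and t: "f t = expval \<rho> ?M - (expval \<rho> Obs)\<^sup>2" and min: "\<And>s. f t \<le> f s"
    unfolding f_def using variance_duality[OF _ herm] by blast
  show "\<exists>t. is_arg_min f (\<lambda>_. True) t"
    using min unfolding is_arg_min_def by (metis linorder_not_less)
  have "min_value f = f t"
    unfolding min_value_def using min by (intro Least_equality) auto
  moreover have "Gamma_wc B P q \<alpha> = ereal (f t)"
    unfolding Gamma_wc_def
  proof (rule antisym)
    show "(SUP \<rho>\<in>{\<rho>. density \<rho>}. ereal (estimator_variance B P q \<alpha> \<rho>)) \<le> ereal (f t)"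
      using max t by (intro SUP_least) (simp add: estimator_variance_eq[OF mf adm])
    show "ereal (f t) \<le> (SUP \<rho>\<in>{\<rho>. density \<rho>}. ereal (estimator_variance B P q \<alpha> \<rho>))"
      using \<rho> t by (intro SUP_upper2[of \<rho>]) (simp_all add: estimator_variance_eq[OF mf adm])
  qed
  ultimately show "Gamma_wc B P q \<alpha> = ereal (min_value f)" by simp
qed

theorem theorem2:
  fixes U :: "'u set" and B :: "'u \<Rightarrow> 'b set"
    and P :: "'u \<Rightarrow> 'b \<Rightarrow> ('n::finite) qop"
    and \<psi> :: "'n qvec"
  assumes "measurement_family U B P"
    and "norm \<psi> = 1"
  shows "(\<forall>q \<alpha>. admissible U B P (rank_one \<psi>) q \<alpha> \<longrightarrow>
            (\<exists>t. is_arg_min (dual_objective (second_moment_op U B P q \<alpha>) (rank_one \<psi>)) (\<lambda>_. True) t) \<and>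
            Gamma_wc B P q \<alpha> =
              ereal (min_value (dual_objective (second_moment_op U B P q \<alpha>) (rank_one \<psi>)))) \<and>
         Gamma_star U B P (rank_one \<psi>) =
           (INF (q, \<alpha>)\<in>{(q, \<alpha>). admissible U B P (rank_one \<psi>) q \<alpha>}.
              ereal (min_value (dual_objective (second_moment_op U B P q \<alpha>) (rank_one \<psi>))))"
  \<comment> \<open>The second claim follows by rewriting each term of the infimum with the
    first.\<close>
  using Gamma_wc_eq[OF assms(1) hermitian_rank_one] unfolding Gamma_star_def
  by (auto intro!: INF_cong)

end
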